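(* The theory $\mathcal{AX}_{\mathtt{diff}}$ has the amalgamation property: whenever $\mathcal N,\mathcal M_1,\mathcal M_2$ are models of $\mathcal{AX}_{\mathtt{diff}}$ and $\mu_1:\mathcal N\to\mathcal M_1$, $\mu_2:\mathcal N\to\mathcal M_2$ are embeddings, there exist a model $\mathcal M$ of $\mathcal{AX}_{\mathtt{diff}}$ and embeddings $\nu_1:\mathcal M_1\to\mathcal M$, $\nu_2:\mathcal M_2\to\mathcal M$ such that $\nu_1\circ\mu_1=\nu_2\circ\mu_2$.
   Context: $\mathcal{AX}_{\mathtt{diff}}$ is the many-sorted first-order theory with equality having sorts $\mathtt{ARRAY},\mathtt{INDEX},\mathtt{ELEM}$, function symbols $rd:\mathtt{ARRAY}\times\mathtt{INDEX}\to\mathtt{ELEM}$, $wr:\mathtt{ARRAY}\times\mathtt{INDEX}\times\mathtt{ELEM}\to\mathtt{ARRAY}$, $\mathtt{diff}:\mathtt{ARRAY}\times\mathtt{ARRAY}\to\mathtt{INDEX}$, and axioms $\forall y,i,e.\ rd(wr(y,i,e),i)=e$; $\forall y,i,j,e.\ i\neq j\Rightarrow rd(wr(y,i,e),j)=rd(y,j)$; $\forall x,y.\ x\neq y\Rightarrow rd(x,\mathtt{diff}(x,y))\neq rd(y,\mathtt{diff}(x,y))$. An embedding between structures is a sort-preserving injective map commuting with all function symbols. Models with empty interpretation of some sort are allowed (the signature has no ground terms). *)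

theory Defs
  imports Main
begin

text \<open>
  Each sort is interpreted by a carrier set inside a type. HOL types are nonempty, but the
  carriers need not be: empty sorts are allowed. The operations are total HOL functions;
  only their values on the carriers matter.
\<close>

record ('a, 'i, 'e) arr_structure =
  ARRAY :: "'a set"
  INDEX :: "'i set"
  ELEM :: "'e set"
  rd :: "'a \<Rightarrow> 'i \<Rightarrow> 'e"
  wr :: "'a \<Rightarrow> 'i \<Rightarrow> 'e \<Rightarrow> 'a"
  diff :: "'a \<Rightarrow> 'a \<Rightarrow> 'i"

locale arr_interpretation =
  fixes M :: "('a, 'i, 'e) arr_structure"
  assumes rd_closed: "\<lbrakk>y \<in> ARRAY M; i \<in> INDEX M\<rbrakk> \<Longrightarrow> rd M y i \<in> ELEM M"
    and wr_closed: "\<lbrakk>y \<in> ARRAY M; i \<in> INDEX M; e \<in> ELEM M\<rbrakk> \<Longrightarrow> wr M y i e \<in> ARRAY M"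
    and diff_closed: "\<lbrakk>x \<in> ARRAY M; y \<in> ARRAY M\<rbrakk> \<Longrightarrow> diff M x y \<in> INDEX M"

locale AX_diff_model = arr_interpretation M
  for M :: "('a, 'i, 'e) arr_structure" +
  assumes rd_wr_same:
      "\<lbrakk>y \<in> ARRAY M; i \<in> INDEX M; e \<in> ELEM M\<rbrakk> \<Longrightarrow> rd M (wr M y i e) i = e"
    and rd_wr_other:
      "\<lbrakk>y \<in> ARRAY M; i \<in> INDEX M; j \<in> INDEX M; e \<in> ELEM M; i \<noteq> j\<rbrakk>
        \<Longrightarrow> rd M (wr M y i e) j = rd M y j"
    and rd_diff:
      "\<lbrakk>x \<in> ARRAY M; y \<in> ARRAY M; x \<noteq> y\<rbrakk>
        \<Longrightarrow> rd M x (diff M x y) \<noteq> rd M y (diff M x y)"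

record ('a, 'i, 'e, 'b, 'j, 'f) sorted_map =
  on_array :: "'a \<Rightarrow> 'b"
  on_index :: "'i \<Rightarrow> 'j"
  on_elem :: "'e \<Rightarrow> 'f"

locale arr_embedding =
  fixes f :: "('a, 'i, 'e, 'b, 'j, 'f) sorted_map"
    and M :: "('a, 'i, 'e) arr_structure"
    and M' :: "('b, 'j, 'f) arr_structure"
  assumes array_into: "x \<in> ARRAY M \<Longrightarrow> on_array f x \<in> ARRAY M'"
    and index_into: "i \<in> INDEX M \<Longrightarrow> on_index f i \<in> INDEX M'"
    and elem_into: "e \<in> ELEM M \<Longrightarrow> on_elem f e \<in> ELEM M'"
    and array_inj: "inj_on (on_array f) (ARRAY M)"
    and index_inj: "inj_on (on_index f) (INDEX M)"
    and elem_inj: "inj_on (on_elem f) (ELEM M)"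
    and commutes_rd:
      "\<lbrakk>y \<in> ARRAY M; i \<in> INDEX M\<rbrakk>
        \<Longrightarrow> on_elem f (rd M y i) = rd M' (on_array f y) (on_index f i)"
    and commutes_wr:
      "\<lbrakk>y \<in> ARRAY M; i \<in> INDEX M; e \<in> ELEM M\<rbrakk>
        \<Longrightarrow> on_array f (wr M y i e) = wr M' (on_array f y) (on_index f i) (on_elem f e)"
    and commutes_diff:
      "\<lbrakk>x \<in> ARRAY M; y \<in> ARRAY M\<rbrakk>
        \<Longrightarrow> on_index f (diff M x y) = diff M' (on_array f x) (on_array f y)"

definition sorted_comp ::
  "('b, 'j, 'f, 'c, 'k, 'g) sorted_map \<Rightarrow> ('a, 'i, 'e, 'b, 'j, 'f) sorted_map
    \<Rightarrow> ('a, 'i, 'e, 'c, 'k, 'g) sorted_map" where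
  "sorted_comp g f = \<lparr>on_array = on_array g \<circ> on_array f,
                      on_index = on_index g \<circ> on_index f,
                      on_elem = on_elem g \<circ> on_elem f\<rparr>"

text \<open>
  Equality as maps with domain \<open>N\<close>: values outside the carriers of \<open>N\<close> are irrelevant.
\<close>

definition eq_maps_on ::
  "('a, 'i, 'e) arr_structure \<Rightarrow> ('a, 'i, 'e, 'b, 'j, 'f) sorted_map
    \<Rightarrow> ('a, 'i, 'e, 'b, 'j, 'f) sorted_map \<Rightarrow> bool" where
  "eq_maps_on N f g \<longleftrightarrow>
     (\<forall>x\<in>ARRAY N. on_array f x = on_array g x) \<and>
     (\<forall>i\<in>INDEX N. on_index f i = on_index g i) \<and>
     (\<forall>e\<in>ELEM N. on_elem f e = on_elem g e)"

text \<open>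
  HOL cannot quantify existentially over types, so the amalgam has to be given host types
  in advance. Indices and elements are taken from the disjoint union of those of the two
  given models and a countable supply of fresh ones. Arrays of a model of the theory are
  determined by their reads, so functions from indices to elements can represent them.
  Nothing forces the carriers of the amalgam to fill these types, nor its operations or the
  embeddings into it to be the ones these types suggest.
\<close>

type_synonym ('x, 'y) amalgam_host = "'x + 'y + nat"

type_synonym ('i, 'e, 'j, 'f) amalgam_structure =
  "(('i, 'j) amalgam_host \<Rightarrow> ('e, 'f) amalgam_host,
    ('i, 'j) amalgam_host, ('e, 'f) amalgam_host) arr_structure"

end

theory Submission
  imports Defs
begin

text \<open>
  Indices and elements are amalgamated as sets, with fresh ones added, and the amalgam consists
  of all functions from indices to elements. An array \<open>a\<close> of \<open>M1\<close> becomes such a function by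
  reading it on the indices of \<open>M1\<close>; on the remaining indices of \<open>M2\<close> it copies an array of \<open>N\<close>
  from which \<open>a\<close> differs at finitely many indices, if there is one. The choice of that array does
  not matter: by repeatedly writing at \<open>diff\<close>, two arrays of \<open>N\<close> with finitely many disagreements
  become equal already inside \<open>N\<close>, so in any extension they disagree at indices of \<open>N\<close> only.
  A fresh index carries a flag that separates the arrays of \<open>M1\<close> and of \<open>M2\<close> having no such
  companion in \<open>N\<close>. The images of \<open>M1\<close> and \<open>M2\<close> then meet only in the image of \<open>N\<close>, and hence
  the two functions \<open>diff\<close> have a common extension.
\<close>

section \<open>Disagreement sets and single writes\<close>

definition disagreement :: "('a, 'i, 'e) arr_structure \<Rightarrow> 'a \<Rightarrow> 'a \<Rightarrow> 'i set" where
  "disagreement M a b = {i \<in> INDEX M. rd M a i \<noteq> rd M b i}"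

lemma disagreement_commute: "disagreement M a b = disagreement M b a"
  by (auto simp: disagreement_def)

lemma disagreement_triangle:
  "disagreement M a c \<subseteq> disagreement M a b \<union> disagreement M b c"
  by (auto simp: disagreement_def)

lemma finite_disagreement_trans:
  assumes "finite (disagreement M a b)" "finite (disagreement M b c)"
  shows "finite (disagreement M a c)"
  using assms disagreement_triangle by (metis finite_UnI finite_subset)

context AX_diff_model
begin

lemma diff_in_disagreement:
  assumes "x \<in> ARRAY M" "y \<in> ARRAY M" "x \<noteq> y"
  shows "diff M x y \<in> disagreement M x y"
  using assms rd_diff diff_closed by (auto simp: disagreement_def)

text \<open>\<open>diff\<close> acts as a Skolem function for extensionality: distinct arrays are
  separated at an index of the model itself.\<close>

lemma array_eqI:
  assumes "x \<in> ARRAY M" "y \<in> ARRAY M" "disagreement M x y = {}"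
  shows "x = y"
  using assms diff_in_disagreement by blast

lemma rd_wr:
  assumes "y \<in> ARRAY M" "i \<in> INDEX M" "j \<in> INDEX M" "e \<in> ELEM M"
  shows "rd M (wr M y i e) j = (if j = i then e else rd M y j)"
  using assms rd_wr_same rd_wr_other by auto

text \<open>Serves as the step of both inductions on the size of a disagreement: values of
  \<open>y\<close> are copied into \<open>x\<close> one index at a time.\<close>

lemma disagreement_wr:
  assumes "x \<in> ARRAY M" "y \<in> ARRAY M" "i \<in> INDEX M"
  shows "disagreement M (wr M x i (rd M y i)) y = disagreement M x y - {i}"
  using assms rd_wr rd_closed by (auto simp: disagreement_def split: if_splits)

lemma disagreement_wr_self:
  assumes "y \<in> ARRAY M" "i \<in> INDEX M" "e \<in> ELEM M"
  shows "disagreement M (wr M y i e) y \<subseteq> {i}"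
  using assms rd_wr by (auto simp: disagreement_def split: if_splits)

end

section \<open>Finite disagreement under an embedding\<close>

locale model_embedding =
  N: AX_diff_model N + M: AX_diff_model M + arr_embedding f N M
  for N :: "('a0, 'i0, 'e0) arr_structure" and M :: "('a, 'i, 'e) arr_structure" and f
begin

lemma rd_eq_iff:
  assumes "c \<in> ARRAY N" "d \<in> ARRAY N" "k \<in> INDEX N"
  shows "rd M (on_array f c) (on_index f k) = rd M (on_array f d) (on_index f k)
    \<longleftrightarrow> rd N c k = rd N d k"
  using assms commutes_rd elem_inj N.rd_closed by (metis inj_onD)

lemma image_disagreement_subset:
  assumes "c \<in> ARRAY N" "d \<in> ARRAY N"
  shows "on_index f ` disagreement N c d \<subseteq> disagreement M (on_array f c) (on_array f d)"
  using assms rd_eq_iff index_into by (auto simp: disagreement_def)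

lemma finite_disagreement_reflect:
  assumes "c \<in> ARRAY N" "d \<in> ARRAY N"
    and "finite (disagreement M (on_array f c) (on_array f d))"
  shows "finite (disagreement N c d)"
proof -
  have "inj_on (on_index f) (disagreement N c d)"
    using index_inj by (rule inj_on_subset) (auto simp: disagreement_def)
  then show ?thesis
    using image_disagreement_subset[OF assms(1,2)] assms(3) finite_imageD finite_subset by blast
qed

text \<open>Finitely many writes at disagreements turn \<open>c\<close> into \<open>d\<close> within
  \<open>N\<close>. The embedding carries them to writes at the images of these indices, so
  \<open>M\<close> sees no change elsewhere.\<close>

lemma disagreement_image:
  assumes "finite (disagreement N c d)" "c \<in> ARRAY N" "d \<in> ARRAY N"
  shows "disagreement M (on_array f c) (on_array f d) \<subseteq> on_index f ` disagreement N c d"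
  using assms
proof (induction "card (disagreement N c d)" arbitrary: c rule: less_induct)
  case less
  show ?case
  proof (cases "c = d")
    case True
    then show ?thesis by (simp add: disagreement_def)
  next
    case False
    define k where "k = diff N c d"
    define c' where "c' = wr N c k (rd N d k)"
    have k: "k \<in> disagreement N c d" "k \<in> INDEX N"
      using N.diff_in_disagreement less.prems False N.diff_closed by (auto simp: k_def)
    have c': "c' \<in> ARRAY N"
      using less.prems k N.wr_closed N.rd_closed by (simp add: c'_def)
    have dis: "disagreement N c' d = disagreement N c d - {k}"
      using less.prems k N.disagreement_wr by (simp add: c'_def)
    have "card (disagreement N c' d) < card (disagreement N c d)"
      unfolding dis using k less.prems(1) by (intro card_Diff1_less)
    moreover have "finite (disagreement N c' d)"
      using less.prems dis by simp
    ultimately have "disagreement M (on_array f c') (on_array f d)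
        \<subseteq> on_index f ` disagreement N c' d"
      using less.hyps c' less.prems by blast
    moreover have "disagreement M (on_array f c') (on_array f c) \<subseteq> {on_index f k}"
      using less.prems k commutes_wr M.disagreement_wr_self array_into index_into elem_into
        N.rd_closed by (simp add: c'_def)
    ultimately show ?thesis
      using disagreement_triangle[of M "on_array f c" "on_array f d" "on_array f c'"] k dis
      by (auto simp: disagreement_commute)
  qed
qed

text \<open>The values of \<open>a\<close> are written into \<open>c\<close> one by one. Each index
  and each value comes from \<open>N\<close>, so the array obtained stays in \<open>N\<close>; once
  no disagreement is left, extensionality in \<open>M\<close> identifies its image with
  \<open>a\<close>.\<close>

lemma in_image_if_disagreement_in_image:
  assumes "finite (disagreement M (on_array f c) a)" "c \<in> ARRAY N" "a \<in> ARRAY M"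
    and "disagreement M (on_array f c) a \<subseteq> on_index f ` INDEX N"
    and "\<And>i. i \<in> disagreement M (on_array f c) a \<Longrightarrow> rd M a i \<in> on_elem f ` ELEM N"
  shows "a \<in> on_array f ` ARRAY N"
  using assms
proof (induction "card (disagreement M (on_array f c) a)" arbitrary: c rule: less_induct)
  case less
  show ?case
  proof (cases "disagreement M (on_array f c) a = {}")
    case True
    then show ?thesis using M.array_eqI less.prems array_into by blast
  next
    case False
    then obtain k where k: "k \<in> INDEX N" "on_index f k \<in> disagreement M (on_array f c) a"
      using less.prems(4) by blast
    then obtain e where e: "e \<in> ELEM N" "rd M a (on_index f k) = on_elem f e"
      using less.prems(5) by blast
    define c' where "c' = wr N c k e"
    have c': "c' \<in> ARRAY N" using N.wr_closed less.prems k e by (simp add: c'_def)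
    have "on_array f c' = wr M (on_array f c) (on_index f k) (rd M a (on_index f k))"
      using commutes_wr less.prems k e by (simp add: c'_def)
    then have dis: "disagreement M (on_array f c') a
        = disagreement M (on_array f c) a - {on_index f k}"
      using M.disagreement_wr array_into index_into less.prems k by simp
    have "card (disagreement M (on_array f c') a) < card (disagreement M (on_array f c) a)"
      unfolding dis using k less.prems(1) by (intro card_Diff1_less)
    then show ?thesis
      using less.hyps[of c'] less.prems c' dis by auto
  qed
qed

end

text \<open>The maps \<open>\<iota>1\<close>, \<open>\<iota>2\<close> and
  \<open>\<epsilon>1\<close>, \<open>\<epsilon>2\<close> amalgamate indices and elements as sets,
  overlapping only over \<open>N\<close>. Keeping them abstract makes the setting symmetric in the
  two models, which a concrete disjoint union would not be. \<open>p\<close> is the fresh index and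
  \<open>z\<close>, \<open>w1\<close>, \<open>w2\<close> are the flag values.\<close>

locale span_amalgamation =
  m1: model_embedding N M1 \<mu>1 + m2: model_embedding N M2 \<mu>2
  for N :: "('a0, 'i0, 'e0) arr_structure"
    and M1 :: "('a1, 'i1, 'e1) arr_structure" and \<mu>1
    and M2 :: "('a2, 'i2, 'e2) arr_structure" and \<mu>2 +
  fixes \<iota>1 :: "'i1 \<Rightarrow> 'i" and \<iota>2 :: "'i2 \<Rightarrow> 'i"
    and \<epsilon>1 :: "'e1 \<Rightarrow> 'e" and \<epsilon>2 :: "'e2 \<Rightarrow> 'e"
    and p :: 'i and z w1 w2 :: 'e
  assumes inj_idx1: "inj_on \<iota>1 (INDEX M1)" and inj_idx2: "inj_on \<iota>2 (INDEX M2)"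
    and inj_el1: "inj_on \<epsilon>1 (ELEM M1)" and inj_el2: "inj_on \<epsilon>2 (ELEM M2)"
    and idx_comm: "k \<in> INDEX N \<Longrightarrow> \<iota>1 (on_index \<mu>1 k) = \<iota>2 (on_index \<mu>2 k)"
    and el_comm: "e \<in> ELEM N \<Longrightarrow> \<epsilon>1 (on_elem \<mu>1 e) = \<epsilon>2 (on_elem \<mu>2 e)"
    and idx_overlap: "\<lbrakk>i \<in> INDEX M1; j \<in> INDEX M2; \<iota>1 i = \<iota>2 j\<rbrakk>
      \<Longrightarrow> \<exists>k\<in>INDEX N. i = on_index \<mu>1 k \<and> j = on_index \<mu>2 k"
    and el_overlap: "\<lbrakk>u \<in> ELEM M1; v \<in> ELEM M2; \<epsilon>1 u = \<epsilon>2 v\<rbrakk>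
      \<Longrightarrow> \<exists>e\<in>ELEM N. u = on_elem \<mu>1 e \<and> v = on_elem \<mu>2 e"
    and fresh1: "p \<notin> \<iota>1 ` INDEX M1" and fresh2: "p \<notin> \<iota>2 ` INDEX M2"
    and flags: "z \<noteq> w1" "z \<noteq> w2" "w1 \<noteq> w2"
begin

section \<open>Extending the arrays of one model to all indices\<close>

definition companion :: "'a1 \<Rightarrow> 'a0 \<Rightarrow> bool" where
  "companion a c \<longleftrightarrow> c \<in> ARRAY N \<and> finite (disagreement M1 a (on_array \<mu>1 c))"

text \<open>Outside the indices of \<open>M1\<close> the value depends on \<open>a\<close> only
  through the predicate \<open>companion a\<close>. The flag \<open>z\<close> is shared by both
  models, whereas \<open>w1\<close> marks arrays of \<open>M1\<close> without a companion.\<close>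

definition extend :: "'a1 \<Rightarrow> 'i \<Rightarrow> 'e" where
  "extend a x =
    (if x \<in> \<iota>1 ` INDEX M1 then \<epsilon>1 (rd M1 a (inv_into (INDEX M1) \<iota>1 x))
     else if \<exists>c. companion a c then
       (if x \<in> \<iota>2 ` INDEX M2
        then \<epsilon>2 (rd M2 (on_array \<mu>2 (SOME c. companion a c)) (inv_into (INDEX M2) \<iota>2 x))
        else z)
     else w1)"

lemma extend_own: "i \<in> INDEX M1 \<Longrightarrow> extend a (\<iota>1 i) = \<epsilon>1 (rd M1 a i)"
  using inj_idx1 by (simp add: extend_def)

text \<open>Two companions differ finitely in \<open>M1\<close>, hence in \<open>N\<close>, so their
  images in \<open>M2\<close> can differ only at indices from \<open>N\<close>. Those already lie in
  the range of \<open>\<iota>1\<close>.\<close>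

lemma companion_rd_eq:
  assumes "companion a c" "companion a d" "j \<in> INDEX M2" "\<iota>2 j \<notin> \<iota>1 ` INDEX M1"
  shows "rd M2 (on_array \<mu>2 c) j = rd M2 (on_array \<mu>2 d) j"
proof (rule ccontr)
  have cd: "c \<in> ARRAY N" "d \<in> ARRAY N" using assms by (auto simp: companion_def)
  have "finite (disagreement M1 (on_array \<mu>1 c) (on_array \<mu>1 d))"
    using assms finite_disagreement_trans disagreement_commute by (metis companion_def)
  then have fin: "finite (disagreement N c d)"
    using m1.finite_disagreement_reflect cd by blast
  assume "rd M2 (on_array \<mu>2 c) j \<noteq> rd M2 (on_array \<mu>2 d) j"
  then have "j \<in> disagreement M2 (on_array \<mu>2 c) (on_array \<mu>2 d)"
    using assms by (simp add: disagreement_def)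
  then obtain k where "k \<in> INDEX N" "j = on_index \<mu>2 k"
    using m2.disagreement_image[OF fin cd] by (auto simp: disagreement_def)
  then show False using assms(4) idx_comm m1.index_into by (metis imageI)
qed

lemma extend_other:
  assumes "companion a c" "j \<in> INDEX M2" "\<iota>2 j \<notin> \<iota>1 ` INDEX M1"
  shows "extend a (\<iota>2 j) = \<epsilon>2 (rd M2 (on_array \<mu>2 c) j)"
proof -
  have "companion a (SOME c. companion a c)" using assms(1) by (rule someI)
  then have "rd M2 (on_array \<mu>2 (SOME c. companion a c)) j = rd M2 (on_array \<mu>2 c) j"
    using companion_rd_eq assms by blast
  then show ?thesis using assms inj_idx2 by (auto simp: extend_def)
qed

lemma extend_outside:
  assumes "x \<notin> \<iota>1 ` INDEX M1" "x \<notin> \<iota>2 ` INDEX M2"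
  shows "extend a x = (if \<exists>c. companion a c then z else w1)"
  using assms by (auto simp: extend_def)

lemma companion_refl: "c \<in> ARRAY N \<Longrightarrow> companion (on_array \<mu>1 c) c"
  by (simp add: companion_def disagreement_def)

text \<open>An index shared by both models comes from \<open>N\<close>, where both read the image of
  \<open>rd N c k\<close>. At any other index \<open>c\<close> is its own companion.\<close>

lemma extend_base:
  assumes "c \<in> ARRAY N" "j \<in> INDEX M2"
  shows "extend (on_array \<mu>1 c) (\<iota>2 j) = \<epsilon>2 (rd M2 (on_array \<mu>2 c) j)"
proof (cases "\<iota>2 j \<in> \<iota>1 ` INDEX M1")
  case True
  then obtain i where i: "i \<in> INDEX M1" "\<iota>1 i = \<iota>2 j" by auto
  then obtain k where k: "k \<in> INDEX N" "i = on_index \<mu>1 k" "j = on_index \<mu>2 k"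
    using idx_overlap assms by blast
  have "extend (on_array \<mu>1 c) (\<iota>2 j) = \<epsilon>1 (rd M1 (on_array \<mu>1 c) i)"
    using extend_own i by metis
  also have "\<dots> = \<epsilon>1 (on_elem \<mu>1 (rd N c k))" using m1.commutes_rd assms k by simp
  also have "\<dots> = \<epsilon>2 (on_elem \<mu>2 (rd N c k))" using el_comm m1.N.rd_closed assms k by simp
  also have "\<dots> = \<epsilon>2 (rd M2 (on_array \<mu>2 c) j)" using m2.commutes_rd assms k by simp
  finally show ?thesis .
next
  case False
  then show ?thesis using extend_other companion_refl assms by blast
qed

lemma companion_wr:
  assumes "a \<in> ARRAY M1" "i \<in> INDEX M1" "e \<in> ELEM M1"
  shows "companion (wr M1 a i e) c \<longleftrightarrow> companion a c"
proof -
  have "finite (disagreement M1 (wr M1 a i e) a)"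
    using m1.M.disagreement_wr_self[OF assms] by (simp add: finite_subset)
  then show ?thesis
    unfolding companion_def
    by (metis disagreement_commute finite_disagreement_trans)
qed

text \<open>A single write leaves the set of companions unchanged, so \<open>SOME\<close> selects
  the same one and no value outside the indices of \<open>M1\<close> moves.\<close>

lemma extend_wr:
  assumes "a \<in> ARRAY M1" "i \<in> INDEX M1" "e \<in> ELEM M1"
  shows "extend (wr M1 a i e) = (extend a)(\<iota>1 i := \<epsilon>1 e)"
proof
  fix x
  show "extend (wr M1 a i e) x = ((extend a)(\<iota>1 i := \<epsilon>1 e)) x"
  proof (cases "x \<in> \<iota>1 ` INDEX M1")
    case True
    then obtain j where "j \<in> INDEX M1" "x = \<iota>1 j" by auto
    then show ?thesis using assms m1.M.rd_wr inj_idx1 by (auto simp: extend_own inj_on_eq_iff)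
  next
    case False
    then have "x \<noteq> \<iota>1 i" using assms by auto
    moreover have "companion (wr M1 a i e) = companion a"
      using companion_wr[OF assms] by blast
    ultimately show ?thesis using False by (auto simp: extend_def)
  qed
qed

lemma extend_inj:
  assumes "a \<in> ARRAY M1" "b \<in> ARRAY M1" "extend a = extend b"
  shows "a = b"
proof (rule m1.M.array_eqI)
  have "rd M1 a i = rd M1 b i" if "i \<in> INDEX M1" for i
    using that assms extend_own inj_el1 m1.M.rd_closed by (metis inj_onD)
  then show "disagreement M1 a b = {}" by (auto simp: disagreement_def)
qed (use assms in auto)

text \<open>Exchanging the models, together with \<open>w1\<close> and \<open>w2\<close>, gives
  every fact about \<open>extend\<close> a mirror image about \<open>sw.extend\<close>.\<close>

lemma swapped: "span_amalgamation N M2 \<mu>2 M1 \<mu>1 \<iota>2 \<iota>1 \<epsilon>2 \<epsilon>1 p z w2 w1"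
  by unfold_locales
    (auto simp: inj_idx1 inj_idx2 inj_el1 inj_el2 idx_comm el_comm fresh1 fresh2 flags
      flags[symmetric] dest: idx_overlap[OF _ _ sym] el_overlap[OF _ _ sym])

interpretation sw: span_amalgamation N M2 \<mu>2 M1 \<mu>1 \<iota>2 \<iota>1 \<epsilon>2 \<epsilon>1 p z w2 w1
  by (rule swapped)

section \<open>The images of the two models meet exactly over \<open>N\<close>\<close>

lemma extend_agree:
  assumes "c \<in> ARRAY N"
  shows "extend (on_array \<mu>1 c) = sw.extend (on_array \<mu>2 c)"
proof
  fix x
  consider i where "i \<in> INDEX M1" "x = \<iota>1 i" | j where "j \<in> INDEX M2" "x = \<iota>2 j"
    | "x \<notin> \<iota>1 ` INDEX M1" "x \<notin> \<iota>2 ` INDEX M2" by blast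
  then show "extend (on_array \<mu>1 c) x = sw.extend (on_array \<mu>2 c) x"
  proof cases
    case 1
    then show ?thesis using assms by (simp add: extend_own sw.extend_base)
  next
    case 2
    then show ?thesis using assms by (simp add: sw.extend_own extend_base)
  next
    case 3
    have "\<exists>c'. companion (on_array \<mu>1 c) c'" "\<exists>c'. sw.companion (on_array \<mu>2 c) c'"
      using assms companion_refl sw.companion_refl by blast+
    then show ?thesis using 3 by (simp add: extend_outside sw.extend_outside)
  qed
qed

lemma extend_overlap:
  assumes a: "a \<in> ARRAY M1" and b: "b \<in> ARRAY M2" and eq: "extend a = sw.extend b"
  shows "\<exists>c\<in>ARRAY N. a = on_array \<mu>1 c \<and> b = on_array \<mu>2 c"
proof -
  \<comment> \<open>The left side is \<open>z\<close> or \<open>w1\<close>, the right side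
    \<open>z\<close> or \<open>w2\<close>; equality forces \<open>z\<close>, so \<open>b\<close> has
    a companion.\<close>
  have "extend a p = sw.extend b p" using eq by simp
  then obtain d where d: "sw.companion b d"
    using fresh1 fresh2 flags by (auto simp: extend_outside sw.extend_outside split: if_splits)
  then have dN: "d \<in> ARRAY N" by (simp add: sw.companion_def)
  let ?D = "disagreement M1 (on_array \<mu>1 d) a"
  let ?D2 = "disagreement M2 b (on_array \<mu>2 d)"
  have D: "\<exists>k\<in>INDEX N. i = on_index \<mu>1 k \<and> on_index \<mu>2 k \<in> ?D2
      \<and> rd M1 a i \<in> on_elem \<mu>1 ` ELEM N" if i: "i \<in> ?D" for i
  proof -
    have i1: "i \<in> INDEX M1" and ne: "rd M1 (on_array \<mu>1 d) i \<noteq> rd M1 a i"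
      using i by (auto simp: disagreement_def)
    have eqi: "\<epsilon>1 (rd M1 a i) = sw.extend b (\<iota>1 i)" using eq extend_own i1 by metis
    have ne': "\<epsilon>1 (rd M1 (on_array \<mu>1 d) i) \<noteq> \<epsilon>1 (rd M1 a i)"
      using ne inj_el1 m1.M.rd_closed m1.array_into dN a i1 by (meson inj_onD)
    \<comment> \<open>Otherwise \<open>sw.extend b\<close> would copy the value of \<open>d\<close>
      at \<open>i\<close>, against \<open>ne'\<close>.\<close>
    have "\<iota>1 i \<in> \<iota>2 ` INDEX M2"
      using sw.extend_other[OF d i1] eqi ne' by auto
    then obtain k where k: "k \<in> INDEX N" "i = on_index \<mu>1 k"
      using idx_overlap i1 by (metis imageE)
    let ?j = "on_index \<mu>2 k"
    have j: "?j \<in> INDEX M2" using k m2.index_into by simp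
    have eqj: "\<epsilon>1 (rd M1 a i) = \<epsilon>2 (rd M2 b ?j)"
      using eqi k idx_comm sw.extend_own j by simp
    have "\<epsilon>1 (rd M1 (on_array \<mu>1 d) i) = \<epsilon>2 (rd M2 (on_array \<mu>2 d) ?j)"
      using extend_own[OF i1] extend_base[OF dN j] idx_comm k by metis
    then have "?j \<in> ?D2" using ne' eqj j by (auto simp: disagreement_def)
    \<comment> \<open>By \<open>eqj\<close> this value occurs in both models, hence comes from
      \<open>N\<close>.\<close>
    moreover have "rd M1 a i \<in> on_elem \<mu>1 ` ELEM N"
      using el_overlap[OF _ _ eqj] m1.M.rd_closed m2.M.rd_closed a b i1 j by blast
    ultimately show ?thesis using k by blast
  qed
  have "finite ?D2" using d by (simp add: sw.companion_def)
  \<comment> \<open>The companion gives finiteness for \<open>?D2\<close>; \<open>\<iota>1\<close>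
    transfers it to \<open>?D\<close>.\<close>
  have "inj_on \<iota>1 ?D" using inj_idx1 by (rule inj_on_subset) (auto simp: disagreement_def)
  moreover have "\<iota>1 ` ?D \<subseteq> \<iota>2 ` ?D2"
    using D idx_comm by (metis image_eqI image_subsetI)
  ultimately have "finite ?D" using \<open>finite ?D2\<close> inj_on_finite[of \<iota>1 ?D "\<iota>2 ` ?D2"] by simp
  then obtain c where c: "c \<in> ARRAY N" "a = on_array \<mu>1 c"
    using m1.in_image_if_disagreement_in_image[of d a] dN a D by blast
  then have "b = on_array \<mu>2 c"
    using extend_agree eq sw.extend_inj b m2.array_into by metis
  then show ?thesis using c by blast
qed

text \<open>A pair of arrays coming from both models comes from \<open>N\<close>, where the
  embeddings commute with \<open>diff\<close>, so the two prescribed indices coincide. The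
  prescriptions also bind when \<open>x = y\<close>, since embeddings must preserve
  \<open>diff\<close> on equal arrays.\<close>

lemma ex_common_diff:
  "\<exists>i. (x \<noteq> y \<longrightarrow> x i \<noteq> y i) \<and>
    (\<forall>a\<in>ARRAY M1. \<forall>a'\<in>ARRAY M1. x = extend a \<and> y = extend a' \<longrightarrow> i = \<iota>1 (diff M1 a a')) \<and>
    (\<forall>b\<in>ARRAY M2. \<forall>b'\<in>ARRAY M2. x = sw.extend b \<and> y = sw.extend b' \<longrightarrow> i = \<iota>2 (diff M2 b b'))"
proof -
  have own: "extend a (\<iota>1 (diff M1 a a')) \<noteq> extend a' (\<iota>1 (diff M1 a a'))"
    if "a \<in> ARRAY M1" "a' \<in> ARRAY M1" "extend a \<noteq> extend a'" for a a'
    using that extend_own m1.M.diff_closed m1.M.rd_diff m1.M.rd_closed inj_el1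
    by (metis inj_onD)
  have own2: "sw.extend b (\<iota>2 (diff M2 b b')) \<noteq> sw.extend b' (\<iota>2 (diff M2 b b'))"
    if "b \<in> ARRAY M2" "b' \<in> ARRAY M2" "sw.extend b \<noteq> sw.extend b'" for b b'
    using that sw.extend_own m2.M.diff_closed m2.M.rd_diff m2.M.rd_closed inj_el2
    by (metis inj_onD)
  have both: "\<iota>1 (diff M1 a a') = \<iota>2 (diff M2 b b')"
    if *: "a \<in> ARRAY M1" "a' \<in> ARRAY M1" "b \<in> ARRAY M2" "b' \<in> ARRAY M2"
      "extend a = sw.extend b" "extend a' = sw.extend b'" for a a' b b'
  proof -
    obtain c where "c \<in> ARRAY N" "a = on_array \<mu>1 c" "b = on_array \<mu>2 c"
      using extend_overlap[of a b] * by blast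
    moreover obtain c' where "c' \<in> ARRAY N" "a' = on_array \<mu>1 c'" "b' = on_array \<mu>2 c'"
      using extend_overlap[of a' b'] * by blast
    ultimately show ?thesis
      using m1.commutes_diff m2.commutes_diff idx_comm m1.N.diff_closed by metis
  qed
  consider a a' where "a \<in> ARRAY M1" "a' \<in> ARRAY M1" "x = extend a" "y = extend a'"
    | b b' where "b \<in> ARRAY M2" "b' \<in> ARRAY M2" "x = sw.extend b" "y = sw.extend b'"
      "\<nexists>a a'. a \<in> ARRAY M1 \<and> a' \<in> ARRAY M1 \<and> x = extend a \<and> y = extend a'"
    | "\<nexists>a a'. a \<in> ARRAY M1 \<and> a' \<in> ARRAY M1 \<and> x = extend a \<and> y = extend a'"
      "\<nexists>b b'. b \<in> ARRAY M2 \<and> b' \<in> ARRAY M2 \<and> x = sw.extend b \<and> y = sw.extend b'"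
    by blast
  then show ?thesis
  proof cases
    case 1
    show ?thesis
    proof (intro exI[of _ "\<iota>1 (diff M1 a a')"] conjI ballI impI)
      show "x (\<iota>1 (diff M1 a a')) \<noteq> y (\<iota>1 (diff M1 a a'))" if "x \<noteq> y"
        using own 1 that by blast
    next
      fix c c' assume "c \<in> ARRAY M1" "c' \<in> ARRAY M1" "x = extend c \<and> y = extend c'"
      then show "\<iota>1 (diff M1 a a') = \<iota>1 (diff M1 c c')" using extend_inj 1 by metis
    next
      fix b b' assume "b \<in> ARRAY M2" "b' \<in> ARRAY M2" "x = sw.extend b \<and> y = sw.extend b'"
      then show "\<iota>1 (diff M1 a a') = \<iota>2 (diff M2 b b')" using both 1 by metis
    qed
  next
    case 2
    show ?thesis
    proof (intro exI[of _ "\<iota>2 (diff M2 b b')"] conjI ballI impI)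
      show "x (\<iota>2 (diff M2 b b')) \<noteq> y (\<iota>2 (diff M2 b b'))" if "x \<noteq> y"
        using own2 2 that by blast
    next
      fix c c' assume "c \<in> ARRAY M2" "c' \<in> ARRAY M2" "x = sw.extend c \<and> y = sw.extend c'"
      then show "\<iota>2 (diff M2 b b') = \<iota>2 (diff M2 c c')" using sw.extend_inj 2 by metis
    qed (use 2 in blast)
  next
    case 3
    have "\<exists>i. x \<noteq> y \<longrightarrow> x i \<noteq> y i" by (auto simp: fun_eq_iff)
    then show ?thesis using 3 by blast
  qed
qed

lemma amalgam_exists:
  "\<exists>(M :: ('i \<Rightarrow> 'e, 'i, 'e) arr_structure) \<nu>1 \<nu>2.
    AX_diff_model M \<and> arr_embedding \<nu>1 M1 M \<and> arr_embedding \<nu>2 M2 M \<and>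
    eq_maps_on N (sorted_comp \<nu>1 \<mu>1) (sorted_comp \<nu>2 \<mu>2)"
proof -
  \<comment> \<open>Choosing an index for each pair \<open>x\<close>, \<open>y\<close> turns the
    pointwise statement into a function.\<close>
  obtain D where D: "\<And>x y. x \<noteq> y \<Longrightarrow> x (D x y) \<noteq> y (D x y)"
    and D1: "\<And>a a'. \<lbrakk>a \<in> ARRAY M1; a' \<in> ARRAY M1\<rbrakk>
      \<Longrightarrow> D (extend a) (extend a') = \<iota>1 (diff M1 a a')"
    and D2: "\<And>b b'. \<lbrakk>b \<in> ARRAY M2; b' \<in> ARRAY M2\<rbrakk>
      \<Longrightarrow> D (sw.extend b) (sw.extend b') = \<iota>2 (diff M2 b b')"
    using ex_common_diff by metis
  define M :: "('i \<Rightarrow> 'e, 'i, 'e) arr_structure" where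
    "M = \<lparr>ARRAY = UNIV, INDEX = UNIV, ELEM = UNIV, rd = \<lambda>x. x, wr = fun_upd, diff = D\<rparr>"
  define \<nu>1 where "\<nu>1 = \<lparr>on_array = extend, on_index = \<iota>1, on_elem = \<epsilon>1\<rparr>"
  define \<nu>2 where "\<nu>2 = \<lparr>on_array = sw.extend, on_index = \<iota>2, on_elem = \<epsilon>2\<rparr>"
  have "AX_diff_model M" by unfold_locales (auto simp: M_def D)
  moreover have "arr_embedding \<nu>1 M1 M"
    using extend_inj inj_idx1 inj_el1
    by unfold_locales (auto simp: M_def \<nu>1_def D1 extend_own extend_wr intro: inj_onI)
  moreover have "arr_embedding \<nu>2 M2 M"
    using sw.extend_inj inj_idx2 inj_el2
    by unfold_locales (auto simp: M_def \<nu>2_def D2 sw.extend_own sw.extend_wr intro: inj_onI)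
  moreover have "eq_maps_on N (sorted_comp \<nu>1 \<mu>1) (sorted_comp \<nu>2 \<mu>2)"
    using extend_agree idx_comm el_comm
    by (simp add: eq_maps_on_def sorted_comp_def \<nu>1_def \<nu>2_def)
  ultimately show ?thesis by blast
qed

end

text \<open>The second leg of the pushout of \<open>f\<close> and \<open>g\<close> restricted to
  \<open>A\<close>, with \<open>Inl\<close> as the first leg. The natural numbers are avoided and
  remain fresh.\<close>

definition glue :: "'x set \<Rightarrow> ('x \<Rightarrow> 'y1) \<Rightarrow> ('x \<Rightarrow> 'y2) \<Rightarrow> 'y2 \<Rightarrow> ('y1, 'y2) amalgam_host" where
  "glue A f g y = (if y \<in> g ` A then Inl (f (inv_into A g y)) else Inr (Inl y))"

lemma glue_image: "\<lbrakk>inj_on g A; x \<in> A\<rbrakk> \<Longrightarrow> glue A f g (g x) = Inl (f x)"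
  by (simp add: glue_def)

lemma glue_eq_Inl:
  assumes "inj_on g A" "Inl u = glue A f g y"
  shows "\<exists>x\<in>A. u = f x \<and> y = g x"
  using assms by (auto simp: glue_def split: if_splits)

lemma inj_on_glue:
  assumes "inj_on f A"
  shows "inj_on (glue A f g) B"
proof (rule inj_onI)
  fix y y' assume eq: "glue A f g y = glue A f g y'"
  show "y = y'"
  proof (cases "y \<in> g ` A \<and> y' \<in> g ` A")
    case True
    then have "f (inv_into A g y) = f (inv_into A g y')" using eq by (simp add: glue_def)
    then have "inv_into A g y = inv_into A g y'"
      using inj_onD[OF assms] True inv_into_into by metis
    then show ?thesis using True inv_into_injective by metis
  next
    case False
    then show ?thesis using eq by (simp add: glue_def split: if_split_asm)
  qed
qed

lemma glue_fresh: "Inr (Inr n) \<noteq> glue A f g y"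
  by (simp add: glue_def)

theorem theorem3p2:
  fixes N :: "('a0, 'i0, 'e0) arr_structure"
    and M1 :: "('a1, 'i1, 'e1) arr_structure"
    and M2 :: "('a2, 'i2, 'e2) arr_structure"
    and \<mu>1 :: "('a0, 'i0, 'e0, 'a1, 'i1, 'e1) sorted_map"
    and \<mu>2 :: "('a0, 'i0, 'e0, 'a2, 'i2, 'e2) sorted_map"
  assumes "AX_diff_model N" and "AX_diff_model M1" and "AX_diff_model M2"
    and "arr_embedding \<mu>1 N M1" and "arr_embedding \<mu>2 N M2"
  shows "\<exists>(M :: ('i1, 'e1, 'i2, 'e2) amalgam_structure) \<nu>1 \<nu>2.
           AX_diff_model M \<and> arr_embedding \<nu>1 M1 M \<and> arr_embedding \<nu>2 M2 M \<and>
           eq_maps_on N (sorted_comp \<nu>1 \<mu>1) (sorted_comp \<nu>2 \<mu>2)"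
proof -
  interpret m1: model_embedding N M1 \<mu>1
    using assms by (simp add: model_embedding_def)
  interpret m2: model_embedding N M2 \<mu>2
    using assms by (simp add: model_embedding_def)
  let ?I = "glue (INDEX N) (on_index \<mu>1) (on_index \<mu>2)"
  let ?E = "glue (ELEM N) (on_elem \<mu>1) (on_elem \<mu>2)"
  have inj: "inj_on ?I (INDEX M2)" "inj_on ?E (ELEM M2)"
    by (rule inj_on_glue m1.index_inj m1.elem_inj)+
  \<comment> \<open>The first \<open>Inr (Inr 0)\<close> is the fresh index; the other three points
    are the flags \<open>z\<close>, \<open>w1\<close>, \<open>w2\<close> among the elements.\<close>
  have "span_amalgamation N M1 \<mu>1 M2 \<mu>2 Inl ?I Inl ?E
      (Inr (Inr 0)) (Inr (Inr 0)) (Inr (Inr 1)) (Inr (Inr 2))"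
  proof (intro span_amalgamation.intro span_amalgamation_axioms.intro)
    fix i j assume "Inl i = ?I j"
    then show "\<exists>k\<in>INDEX N. i = on_index \<mu>1 k \<and> j = on_index \<mu>2 k"
      by (rule glue_eq_Inl[OF m2.index_inj])
  next
    fix u v assume "Inl u = ?E v"
    then show "\<exists>e\<in>ELEM N. u = on_elem \<mu>1 e \<and> v = on_elem \<mu>2 e"
      by (rule glue_eq_Inl[OF m2.elem_inj])
  next
    show "inj_on ?I (INDEX M2)" "inj_on ?E (ELEM M2)" by (fact inj)+
  next
    fix k assume "k \<in> INDEX N"
    then show "Inl (on_index \<mu>1 k) = ?I (on_index \<mu>2 k)"
      by (rule glue_image[OF m2.index_inj, symmetric])
  next
    fix e assume "e \<in> ELEM N"
    then show "Inl (on_elem \<mu>1 e) = ?E (on_elem \<mu>2 e)"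
      by (rule glue_image[OF m2.elem_inj, symmetric])
  qed (auto simp: m1.model_embedding_axioms m2.model_embedding_axioms glue_fresh)
  then show ?thesis by (rule span_amalgamation.amalgam_exists)
qed

end
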